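(* Let $\{X_n\}_{n=0}^{\infty}$ be a sequence of independent real Gaussian variables with $\mathbb{E}X_n=\mu_n$ and $\mathrm{Var}(X_n)=\sigma_n^2$ for $n\geq0$, and let $0<p<\infty$. Then $\{X_n\}_{n=0}^{\infty}$ has the $L_p$-property if and only if both of the following hold: (1) $\{\sigma_n\}_{n=0}^{\infty}\in\ell^\infty$; and (2) $\{\mu_n\}_{n=0}^{\infty}$ is a coefficient multiplier from $H^2$ to $H^p$.
   Context: $\mathbb{D}$ is the open unit disk in $\mathbb{C}$, and $H^p=H^p(\mathbb{D})$, $0<p<\infty$, is the Hardy space of analytic functions on $\mathbb{D}$; $H^2$ consists of the series $\sum_{n\ge0} a_nz^n$ with complex coefficients $\{a_n\}\in\ell^2$. A sequence of random variables $\{X_n\}_{n=0}^\infty$ has the $L_p$-property if for any $f(z)=\sum_{n=0}^\infty a_nz^n\in H^2$ one has $\sum_{n=0}^\infty a_nX_nz^n\in H^p$ almost surely. A sequence $\{\lambda_n\}_{n=0}^\infty$ of scalars is a coefficient multiplier from $H^2$ to $H^p$ if $\sum_{n=0}^\infty a_n\lambda_nz^n\in H^p$ for every $f(z)=\sum_{n=0}^\infty a_nz^n\in H^2$. *)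

theory Defs
  imports "HOL-Probability.Probability" "HOL-Complex_Analysis.Complex_Analysis"
begin

definition hardy_space :: "real \<Rightarrow> (complex \<Rightarrow> complex) set" where
  "hardy_space p = {f. f holomorphic_on ball 0 1 \<and>
     bdd_above ((\<lambda>r. 1 / (2 * pi) *
       (LINT t:{0..2*pi}|lborel. cmod (f (of_real r * cis t)) powr p)) ` {0..<1})}"

text \<open>Convergence in the whole disk is part of the requirement, so that the
  value of \<open>suminf\<close> on a divergent series never plays a role.\<close>

definition series_in_hardy :: "real \<Rightarrow> (nat \<Rightarrow> complex) \<Rightarrow> bool" where
  "series_in_hardy p c \<longleftrightarrow>
     (\<exists>f\<in>hardy_space p. \<forall>z\<in>ball 0 1. (\<lambda>n. c n * z ^ n) sums f z)"

text \<open>The Hardy space with exponent 2, given by square-summable coefficient sequences.\<close>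

definition H2_coeffs :: "(nat \<Rightarrow> complex) set" where
  "H2_coeffs = {a. summable (\<lambda>n. (cmod (a n))\<^sup>2)}"

definition L_property :: "'a measure \<Rightarrow> real \<Rightarrow> (nat \<Rightarrow> 'a \<Rightarrow> complex) \<Rightarrow> bool" where
  "L_property M p X \<longleftrightarrow>
     (\<forall>a\<in>H2_coeffs. AE \<omega> in M. series_in_hardy p (\<lambda>n. a n * X n \<omega>))"

definition H2_multiplier :: "real \<Rightarrow> (nat \<Rightarrow> complex) \<Rightarrow> bool" where
  "H2_multiplier p l \<longleftrightarrow> (\<forall>a\<in>H2_coeffs. series_in_hardy p (\<lambda>n. a n * l n))"

text \<open>\<open>normal_density m 0\<close> is identically 0 (division by zero), so the degenerate
  Gaussian law, a point mass, has to be given separately.\<close>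

definition gaussian_law :: "real \<Rightarrow> real \<Rightarrow> real measure" where
  "gaussian_law m s =
     (if s = 0 then return borel m else density lborel (normal_density m s))"

definition gaussian_rv :: "'a measure \<Rightarrow> ('a \<Rightarrow> real) \<Rightarrow> bool" where
  "gaussian_rv M Y \<longleftrightarrow>
     Y \<in> borel_measurable M \<and> (\<exists>m s. s \<ge> 0 \<and> distr M borel Y = gaussian_law m s)"

end

theory Submission
  imports Defs
begin

text \<open>
  Reflecting any set of coordinates, $X_n \mapsto 2\mu_n - X_n$, preserves the joint law of the
  sequence. Reflecting all of them and adding shows that the $L_p$-property makes $\mu$ a
  multiplier. Reflecting only $X_n$ and subtracting leaves the monomial
  $2 a_n (X_n - \mu_n) z^n$, whose $H^p$-size is then bounded with probability at least
  $1/2$ by a constant independent of $n$; since a Gaussian of deviation $\sigma_n$ does not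
  concentrate near its mean, $a_n \sigma_n$ is bounded for every $a \in \ell^2$, and so is $\sigma$.

  Conversely, for $2k \ge p$ the $2k$-th means of the partial sums of
  $\sum a_n (X_n - \mu_n) z^n$ are increasing in the radius, so on the whole disk they are
  bounded by their values on the unit circle, whose expectation is bounded through the
  exponential moments of Gaussian sums.
\<close>

section \<open>Hardy means\<close>

text \<open>Left without the factor \<open>1 / (2 * pi)\<close> of \<open>hardy_space\<close>,
  because only finiteness of the means is at stake. Values in \<open>ennreal\<close> make monotone
  bounds and Fatou's lemma available without integrability conditions.\<close>

definition circle_mean :: "real \<Rightarrow> (nat \<Rightarrow> complex) \<Rightarrow> real \<Rightarrow> ennreal" where
  "circle_mean p c r =
     (\<integral>\<^sup>+t\<in>{0..2*pi}. ennreal (cmod (\<Sum>n. c n * (of_real r * cis t) ^ n) powr p) \<partial>lborel)"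

text \<open>The supremum runs over rational radii so that it is visibly measurable when the
  coefficients are random; by Fatou's lemma it dominates all radii.\<close>

definition hardy_size :: "real \<Rightarrow> (nat \<Rightarrow> complex) \<Rightarrow> ennreal" where
  "hardy_size p c =
     (if 1 \<le> conv_radius c then SUP r\<in>\<rat> \<inter> {0..<1}. circle_mean p c r else \<infinity>)"

section \<open>Power series in the disk and membership in the Hardy space\<close>

lemma summable_in_disk:
  fixes c :: "nat \<Rightarrow> complex"
  assumes "1 \<le> conv_radius c" "cmod z < 1"
  shows "summable (\<lambda>n. c n * z ^ n)"
proof (rule summable_in_conv_radius)
  have "ereal (cmod z) < 1" using assms by (simp add: one_ereal_def)
  thus "ereal (cmod z) < conv_radius c" using assms(1) by (rule less_le_trans)
qed

lemma sums_in_disk: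
  fixes c :: "nat \<Rightarrow> complex"
  assumes "1 \<le> conv_radius c" "z \<in> ball 0 1"
  shows "(\<lambda>n. c n * z ^ n) sums (\<Sum>n. c n * z ^ n)"
  by (rule summable_sums, rule summable_in_disk) (use assms in auto)

text \<open>Turns the pointwise convergence demanded by \<open>series_in_hardy\<close> into a
  condition on the coefficients alone, which can later be shown measurable.\<close>

lemma one_le_conv_radius_iff:
  fixes c :: "nat \<Rightarrow> complex"
  shows "1 \<le> conv_radius c \<longleftrightarrow> (\<forall>z\<in>ball 0 1. summable (\<lambda>n. c n * z ^ n))"
proof
  assume *: "\<forall>z\<in>ball 0 1. summable (\<lambda>n. c n * z ^ n)"
  show "1 \<le> conv_radius c"
    by (rule conv_radius_geI_ex') (use * in \<open>auto simp: one_ereal_def\<close>)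
qed (auto intro: summable_in_disk)

lemma holomorphic_in_disk:
  fixes c :: "nat \<Rightarrow> complex"
  assumes "1 \<le> conv_radius c"
  shows "(\<lambda>z. \<Sum>n. c n * z ^ n) holomorphic_on ball 0 1"
  by (rule power_series_holomorphic[where a = c]) (use assms sums_in_disk in auto)

lemma continuous_in_disk:
  fixes c :: "nat \<Rightarrow> complex"
  assumes "1 \<le> conv_radius c"
  shows "continuous_on (ball 0 1) (\<lambda>z. \<Sum>n. c n * z ^ n)"
  using holomorphic_in_disk[OF assms] by (rule holomorphic_on_imp_continuous_on)

lemma continuous_on_cmod_powr_circle:
  assumes "1 \<le> conv_radius c" "0 \<le> r" "r < 1" "0 < p"
  shows "continuous_on UNIV (\<lambda>t. cmod (\<Sum>n. c n * (of_real r * cis t) ^ n) powr p)"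
proof (intro continuous_on_powr' continuous_on_norm)
  show "continuous_on UNIV (\<lambda>t. \<Sum>n. c n * (of_real r * cis t) ^ n)"
    by (rule continuous_on_compose2[OF continuous_in_disk[OF assms(1)]])
       (use assms in \<open>auto intro!: continuous_intros simp: norm_mult\<close>)
qed (use assms in \<open>auto intro!: continuous_intros\<close>)

text \<open>The integrand is continuous on a compact interval, hence integrable, so the Lebesgue
  integral in \<open>hardy_space\<close> is a genuine value rather than the default 0.\<close>

lemma circle_mean_eq_integral:
  assumes "1 \<le> conv_radius c" "0 \<le> r" "r < 1" "0 < p"
  shows "circle_mean p c r =
    ennreal (LINT t:{0..2*pi}|lborel. cmod (\<Sum>n. c n * (of_real r * cis t) ^ n) powr p)"
proof -
  let ?f = "\<lambda>t. cmod (\<Sum>n. c n * (of_real r * cis t) ^ n) powr p"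
  have "set_integrable lborel {0..2*pi} ?f"
    using continuous_on_subset[OF continuous_on_cmod_powr_circle[OF assms], of "{0..2*pi}"]
    unfolding set_integrable_def
    by (intro borel_integrable_compact) auto
  hence "integrable lborel (\<lambda>t. indicator {0..2*pi} t *\<^sub>R ?f t)"
    by (simp add: set_integrable_def)
  from nn_integral_eq_integral[OF this]
  have "(\<integral>\<^sup>+t. ennreal (indicator {0..2*pi} t *\<^sub>R ?f t) \<partial>lborel) =
      ennreal (LINT t:{0..2*pi}|lborel. ?f t)"
    by (simp add: set_lebesgue_integral_def indicator_def)
  moreover have "(\<integral>\<^sup>+t. ennreal (indicator {0..2*pi} t *\<^sub>R ?f t) \<partial>lborel) = circle_mean p c r"
    unfolding circle_mean_def
    by (intro nn_integral_cong) (auto simp: indicator_def)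
  ultimately show ?thesis by simp
qed

lemma circle_mean_le_hardy_size:
  assumes c: "1 \<le> conv_radius c" and r: "0 \<le> r" "r < 1" and p: "0 < p"
  shows "circle_mean p c r \<le> hardy_size p c"
proof -
  let ?F = "\<lambda>r t. cmod (\<Sum>n. c n * (of_real r * cis t) ^ n) powr p"
  \<comment> \<open>Rational radii approach \<open>r\<close> from the right, which keeps them
    nonnegative even for \<open>r = 0\<close>; the minimum with 1 keeps them inside the
    disk.\<close>
  have "\<exists>s. s \<in> \<rat> \<and> r < s \<and> s < min 1 (r + 1 / real (Suc k))" for k
    using Rats_dense_in_real[of r "min 1 (r + 1 / real (Suc k))"] r by auto
  then obtain s where s: "\<And>k. s k \<in> \<rat>" "\<And>k. r < s k" "\<And>k. s k < min 1 (r + 1 / real (Suc k))"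
    by metis
  have "s \<longlonglongrightarrow> r"
  proof (rule tendsto_sandwich[of "\<lambda>_. r" s sequentially "\<lambda>k. r + 1 / real (Suc k)"])
    have "(\<lambda>k. r + 1 / real (Suc k)) \<longlonglongrightarrow> r + 0"
      by (intro tendsto_intros LIMSEQ_Suc lim_1_over_n)
    thus "(\<lambda>k. r + 1 / real (Suc k)) \<longlonglongrightarrow> r" by simp
  qed (use s in \<open>auto intro!: always_eventually less_imp_le\<close>)
  have lim: "(\<lambda>k. ?F (s k) t) \<longlonglongrightarrow> ?F r t" for t
  proof (intro tendsto_powr2 tendsto_norm)
    show "(\<lambda>k. \<Sum>n. c n * (of_real (s k) * cis t) ^ n) \<longlonglongrightarrow> (\<Sum>n. c n * (of_real r * cis t) ^ n)"
    proof (rule continuous_on_tendsto_compose[OF continuous_in_disk[OF c]])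
      show "(\<lambda>k. of_real (s k) * cis t) \<longlonglongrightarrow> of_real r * cis t"
        by (intro tendsto_intros \<open>s \<longlonglongrightarrow> r\<close>)
      show "\<forall>\<^sub>F k in sequentially. of_real (s k) * cis t \<in> ball 0 1"
      proof (intro always_eventually allI)
        fix k
        have "0 < s k" "s k < 1" using s(2,3)[of k] r by auto
        thus "of_real (s k) * cis t \<in> ball 0 1" by (simp add: norm_mult)
      qed
    qed (use r in \<open>auto simp: norm_mult\<close>)
  qed (use p in auto)
  have "circle_mean p c r =
      (\<integral>\<^sup>+t. liminf (\<lambda>k. ennreal (?F (s k) t) * indicator {0..2*pi} t) \<partial>lborel)"
    unfolding circle_mean_def
  proof (intro nn_integral_cong)
    fix t
    have "(\<lambda>k. ennreal (?F (s k) t) * indicator {0..2*pi} t)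
        \<longlonglongrightarrow> ennreal (?F r t) * indicator {0..2*pi} t"
      using lim[of t] by (auto simp: indicator_def intro!: tendsto_ennrealI)
    from lim_imp_Liminf[OF _ this]
    show "ennreal (?F r t) * indicator {0..2*pi} t =
        liminf (\<lambda>k. ennreal (?F (s k) t) * indicator {0..2*pi} t)" by simp
  qed
  also have "\<dots> \<le> liminf (\<lambda>k. circle_mean p c (s k))"
    unfolding circle_mean_def
  proof (intro nn_integral_liminf)
    fix k
    have "(\<lambda>t. ?F (s k) t) \<in> borel_measurable borel"
      by (intro borel_measurable_continuous_onI continuous_on_cmod_powr_circle)
         (use c r s[of k] p in auto)
    thus "(\<lambda>t. ennreal (?F (s k) t) * indicator {0..2*pi} t) \<in> borel_measurable lborel"
      by simp
  qed
  also have "\<dots> \<le> liminf (\<lambda>k::nat. hardy_size p c)"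
  proof (intro Liminf_mono always_eventually allI)
    fix k
    have "s k \<in> \<rat> \<inter> {0..<1}" using s[of k] r by auto
    thus "circle_mean p c (s k) \<le> hardy_size p c"
      unfolding hardy_size_def using c by (auto intro: SUP_upper)
  qed
  also have "\<dots> = hardy_size p c" by (simp add: Liminf_const)
  finally show ?thesis .
qed

text \<open>Recasts membership as finiteness of one extended number, which can be added, compared
  and made random. A bound \<open>B\<close> for the normalised means corresponds to
  \<open>2 * pi * B\<close> here.\<close>

lemma series_in_hardy_iff:
  assumes p: "0 < p"
  shows "series_in_hardy p c \<longleftrightarrow> hardy_size p c < \<infinity>"
proof
  assume "series_in_hardy p c"
  then obtain f where f: "f \<in> hardy_space p" "\<And>z. z \<in> ball 0 1 \<Longrightarrow> (\<lambda>n. c n * z ^ n) sums f z"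
    unfolding series_in_hardy_def by auto
  have c: "1 \<le> conv_radius c"
    unfolding one_le_conv_radius_iff using f(2) by (auto simp: sums_iff)
  let ?m = "\<lambda>r. 1 / (2 * pi) * (LINT t:{0..2*pi}|lborel. cmod (f (of_real r * cis t)) powr p)"
  have "bdd_above (?m ` {0..<1})"
    using f(1) unfolding hardy_space_def mem_Collect_eq by (rule conjunct2)
  then obtain B where "\<forall>x\<in>?m ` {0..<1}. x \<le> B"
    unfolding bdd_above_def by blast
  hence B: "?m r \<le> B" if "r \<in> {0..<1}" for r
    using that by blast
  have "circle_mean p c r \<le> ennreal (2 * pi * B)" if r: "r \<in> {0..<1}" for r
  proof -
    have "f (of_real r * cis t) = (\<Sum>n. c n * (of_real r * cis t) ^ n)" for t
      by (rule sums_unique[OF f(2)]) (use r in \<open>auto simp: norm_mult\<close>)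
    with B[OF r] show ?thesis
      using r p by (subst circle_mean_eq_integral[OF c]) (auto intro!: ennreal_leI simp: field_simps)
  qed
  hence "hardy_size p c \<le> ennreal (2 * pi * B)"
    unfolding hardy_size_def using c by (auto intro!: SUP_least)
  thus "hardy_size p c < \<infinity>"
    by (rule order.strict_trans1) simp
next
  assume fin: "hardy_size p c < \<infinity>"
  hence c: "1 \<le> conv_radius c" by (auto simp: hardy_size_def split: if_splits)
  let ?f = "\<lambda>z. \<Sum>n. c n * z ^ n"
  obtain B where B: "hardy_size p c = ennreal B" "B \<ge> 0"
    using fin by (cases "hardy_size p c") auto
  have "?f \<in> hardy_space p"
    unfolding hardy_space_def
  proof (intro CollectI conjI holomorphic_in_disk c bdd_aboveI2)
    fix r :: real assume r: "r \<in> {0..<1}"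
    have "(LINT t:{0..2*pi}|lborel. cmod (?f (of_real r * cis t)) powr p) \<le> B"
      using circle_mean_le_hardy_size[OF c _ _ p, of r] circle_mean_eq_integral[OF c _ _ p, of r] r B
      by (auto simp: ennreal_le_iff)
    thus "1 / (2 * pi) * (LINT t:{0..2*pi}|lborel. cmod (?f (of_real r * cis t)) powr p)
        \<le> 1 / (2 * pi) * B"
      by (intro mult_left_mono) auto
  qed
  thus "series_in_hardy p c"
    unfolding series_in_hardy_def by (intro bexI[of _ ?f] ballI sums_in_disk c)
qed

section \<open>Quasi-norm inequality and measurability\<close>

lemma powr_norm_add_le:
  fixes u v :: "'a::real_normed_vector"
  assumes "0 < p"
  shows "norm (u + v) powr p \<le> 2 powr p * (norm u powr p + norm v powr p)"
proof -
  \<comment> \<open>Twice the larger norm dominates the norm of the sum, an estimate that treats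
    \<open>p < 1\<close> and \<open>p \<ge> 1\<close> alike.\<close>
  have "norm (u + v) powr p \<le> (2 * max (norm u) (norm v)) powr p"
    using norm_triangle_ineq[of u v] assms by (intro powr_mono2) auto
  also have "\<dots> = 2 powr p * max (norm u) (norm v) powr p"
    by (rule powr_mult)
  also have "\<dots> \<le> 2 powr p * (norm u powr p + norm v powr p)"
    by (intro mult_left_mono) (auto simp: max_def)
  finally show ?thesis .
qed

text \<open>Stated as an inequality rather than as closure under sums, because
  \<open>coefficient_bound_if_AE_finite\<close> needs a bound depending only on the two
  sizes.\<close>

lemma hardy_size_add_le:
  assumes p: "0 < p"
  shows "hardy_size p (\<lambda>n. c n + d n) \<le> ennreal (2 powr p) * (hardy_size p c + hardy_size p d)"
proof (cases "1 \<le> conv_radius c \<and> 1 \<le> conv_radius d")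
  case True
  hence c: "1 \<le> conv_radius c" and d: "1 \<le> conv_radius d" by auto
  have cd: "1 \<le> conv_radius (\<lambda>n. c n + d n)"
    using order.trans[OF _ conv_radius_add_ge[of c d]] c d by auto
  let ?F = "\<lambda>c r t. cmod (\<Sum>n. c n * (of_real r * cis t) ^ n) powr p"
  have "circle_mean p (\<lambda>n. c n + d n) r \<le> ennreal (2 powr p) * (circle_mean p c r + circle_mean p d r)"
    if r: "r \<in> {0..<1}" for r
  proof -
    have [measurable]: "?F c r \<in> borel_measurable borel" "?F d r \<in> borel_measurable borel"
      using r p c d by (auto intro!: borel_measurable_continuous_onI continuous_on_cmod_powr_circle)
    have "circle_mean p (\<lambda>n. c n + d n) r \<le>
        (\<integral>\<^sup>+t. ennreal (2 powr p) * (ennreal (?F c r t) * indicator {0..2*pi} t +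
            ennreal (?F d r t) * indicator {0..2*pi} t) \<partial>lborel)"
      unfolding circle_mean_def
    proof (intro nn_integral_mono)
      fix t :: real
      have "summable (\<lambda>n. c n * (of_real r * cis t) ^ n)" "summable (\<lambda>n. d n * (of_real r * cis t) ^ n)"
        using r by (auto intro!: summable_in_disk c d simp: norm_mult)
      hence eq: "(\<Sum>n. (c n + d n) * (of_real r * cis t) ^ n) =
          (\<Sum>n. c n * (of_real r * cis t) ^ n) + (\<Sum>n. d n * (of_real r * cis t) ^ n)"
        by (simp add: suminf_add algebra_simps)
      have "ennreal (?F (\<lambda>n. c n + d n) r t) \<le> ennreal (2 powr p * (?F c r t + ?F d r t))"
        unfolding eq by (intro ennreal_leI powr_norm_add_le p)
      also have "\<dots> = ennreal (2 powr p) * (ennreal (?F c r t) + ennreal (?F d r t))"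
        by (simp add: ennreal_mult)
      finally show "ennreal (?F (\<lambda>n. c n + d n) r t) * indicator {0..2*pi} t \<le>
        ennreal (2 powr p) * (ennreal (?F c r t) * indicator {0..2*pi} t +
            ennreal (?F d r t) * indicator {0..2*pi} t)"
        by (auto simp: indicator_def)
    qed
    also have "\<dots> = ennreal (2 powr p) * (circle_mean p c r + circle_mean p d r)"
      unfolding circle_mean_def by (simp add: nn_integral_cmult nn_integral_add)
    finally show ?thesis .
  qed
  moreover have "circle_mean p c r + circle_mean p d r \<le> hardy_size p c + hardy_size p d"
    if "r \<in> {0..<1}" for r
    using that by (intro add_mono circle_mean_le_hardy_size c d p) auto
  ultimately show ?thesis
    unfolding hardy_size_def[of p "\<lambda>n. c n + d n"] using cd
    by (auto intro!: SUP_least) (meson atLeastLessThan_iff mult_left_mono order_trans zero_le)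
next
  \<comment> \<open>One of the sizes on the right is then infinite and the factor
    \<open>2 powr p\<close> is positive, so the bound is trivial.\<close>
  case False
  thus ?thesis by (auto simp: hardy_size_def ennreal_mult_top)
qed

lemma hardy_size_measurable [measurable]:
  assumes [measurable]: "\<And>n. c n \<in> borel_measurable M"
  shows "(\<lambda>\<omega>. hardy_size p (\<lambda>n. c n \<omega>)) \<in> borel_measurable M"
proof -
  have [measurable]: "root n \<in> borel_measurable borel" for n
    by (intro borel_measurable_continuous_onI) (auto intro!: continuous_intros)
  \<comment> \<open>By the Cauchy-Hadamard formula the radius is the inverse of this limsup, which
    is measurable; its nonnegativity allows the inequality to be inverted in
    \<open>ereal\<close>.\<close>
  have "(1 \<le> conv_radius (\<lambda>n. c n \<omega>)) = (limsup (\<lambda>n. ereal (root n (cmod (c n \<omega>)))) \<le> 1)" for \<omega>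
  proof -
    have "limsup (\<lambda>n. ereal (root n (cmod (c n \<omega>)))) \<ge> limsup (\<lambda>n::nat. 0)"
      by (intro Limsup_mono always_eventually) (auto simp: real_root_ge_zero)
    hence "limsup (\<lambda>n. ereal (root n (cmod (c n \<omega>)))) \<ge> 0" by (simp add: Limsup_const)
    thus ?thesis unfolding conv_radius_def
      by (cases "limsup (\<lambda>n. ereal (root n (cmod (c n \<omega>))))")
         (auto simp: one_ereal_def divide_simps)
  qed
  hence [measurable]: "Measurable.pred M (\<lambda>\<omega>. 1 \<le> conv_radius (\<lambda>n. c n \<omega>))" by simp
  have [measurable]: "cis \<in> borel_measurable borel"
    by (intro borel_measurable_continuous_onI) (auto intro!: continuous_intros)
  have [measurable]: "(\<lambda>\<omega>. circle_mean p (\<lambda>n. c n \<omega>) r) \<in> borel_measurable M" for r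
    unfolding circle_mean_def by measurable
  have "countable (\<rat> \<inter> {0..<1::real})"
    using countable_rat by (rule countable_subset[rotated]) auto
  thus ?thesis unfolding hardy_size_def by measurable
qed

section \<open>Parseval's identity and comparison of exponents\<close>

lemma integral_cis_mult_cnj:
  "((\<lambda>t. cis (real i * t) * cnj (cis (real j * t))) has_integral (if i = j then of_real (2 * pi) else 0))
     {0..2*pi}"
proof (cases "i = j")
  case True
  have "((\<lambda>t::real. 1::complex) has_integral of_real (2*pi)) {0..2*pi}"
    using has_integral_const_real[of "1::complex" 0 "2*pi"] by (simp add: scaleR_conv_of_real)
  thus ?thesis using True by (simp add: cis_cnj cis_mult)
next
  case False
  define k where "k = real i - real j"
  have k: "k \<noteq> 0" using False by (simp add: k_def)
  \<comment> \<open>As \<open>k\<close> is a nonzero integer, the antiderivative takes the same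
    value at both ends of the interval, so the integral vanishes.\<close>
  have "((\<lambda>t. cis (k * t)) has_integral (cis (k * (2*pi)) / (\<i> * of_real k) - cis (k * 0) / (\<i> * of_real k))) {0..2*pi}"
  proof (rule fundamental_theorem_of_calculus)
    fix x :: real
    have "((\<lambda>z. exp (\<i> * of_real k * z) / (\<i> * of_real k)) has_field_derivative exp (\<i> * of_real k * of_real x)) (at (of_real x))"
      using k by (auto intro!: derivative_eq_intros)
    from has_vector_derivative_real_field[OF this]
    show "((\<lambda>x. cis (k * x) / (\<i> * of_real k)) has_vector_derivative cis (k * x)) (at x within {0..2*pi})"
      by (auto simp: cis_conv_exp algebra_simps intro: has_vector_derivative_at_within)
  qed auto
  also have "cis (k * (2*pi)) = 1"
    using cis_multiple_2pi[of k] by (simp add: k_def algebra_simps)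
  finally show ?thesis using False by (simp add: cis_cnj cis_mult k_def algebra_simps)
qed

text \<open>Expanding the squared modulus as a double sum leaves only the diagonal, by orthogonality
  of the functions \<open>cis (real i * t)\<close>.\<close>

lemma Parseval_poly:
  "((\<lambda>t. (cmod (\<Sum>i\<le>d. c i * (of_real r * cis t) ^ i))\<^sup>2) has_integral
     2 * pi * (\<Sum>i\<le>d. (cmod (c i))\<^sup>2 * r ^ (2 * i))) {0..2*pi}"
proof -
  let ?b = "\<lambda>i. c i * of_real (r ^ i)"
  have "((\<lambda>t. \<Sum>i\<le>d. \<Sum>j\<le>d. (?b i * cnj (?b j)) * (cis (real i * t) * cnj (cis (real j * t))))
     has_integral (\<Sum>i\<le>d. \<Sum>j\<le>d. (?b i * cnj (?b j)) * (if i = j then of_real (2 * pi) else 0)))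
     {0..2*pi}"
    by (intro has_integral_sum has_integral_mult_right integral_cis_mult_cnj) auto
  also have "(\<lambda>t. \<Sum>i\<le>d. \<Sum>j\<le>d. (?b i * cnj (?b j)) * (cis (real i * t) * cnj (cis (real j * t)))) =
      (\<lambda>t. of_real ((cmod (\<Sum>i\<le>d. c i * (of_real r * cis t) ^ i))\<^sup>2))"
  proof
    fix t
    have "(\<Sum>i\<le>d. c i * (of_real r * cis t) ^ i) = (\<Sum>i\<le>d. ?b i * cis (real i * t))"
      by (simp add: power_mult_distrib Complex.DeMoivre mult.assoc)
    thus "(\<Sum>i\<le>d. \<Sum>j\<le>d. (?b i * cnj (?b j)) * (cis (real i * t) * cnj (cis (real j * t)))) =
      of_real ((cmod (\<Sum>i\<le>d. c i * (of_real r * cis t) ^ i))\<^sup>2)"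
      by (simp only: complex_norm_square cnj_sum sum_product complex_cnj_mult mult_ac)
  qed
  also have "(\<Sum>i\<le>d. \<Sum>j\<le>d. (?b i * cnj (?b j)) * (if i = j then of_real (2 * pi) else 0)) =
      of_real (2 * pi * (\<Sum>i\<le>d. (cmod (c i))\<^sup>2 * r ^ (2 * i)))"
  proof -
    have b: "?b i * cnj (?b i) = of_real ((cmod (c i))\<^sup>2 * r ^ (2 * i))" for i
    proof -
      have "(cmod (?b i))\<^sup>2 = (cmod (c i))\<^sup>2 * r ^ (2 * i)"
        by (simp add: norm_mult norm_power power_mult_distrib power_mult mult.commute[of 2]
            flip: power_mult)
           (simp add: power_mult power2_abs mult.commute[of _ 2])
      thus ?thesis by (simp only: complex_norm_square[symmetric])
    qed
    have "(\<Sum>j\<le>d. (?b i * cnj (?b j)) * (if i = j then of_real (2 * pi) else 0)) =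
        (?b i * cnj (?b i)) * of_real (2 * pi)" if "i \<le> d" for i
      using that by (simp add: if_distrib[of "\<lambda>x. _ * x"] cong: if_cong)
    hence "(\<Sum>i\<le>d. \<Sum>j\<le>d. (?b i * cnj (?b j)) * (if i = j then of_real (2 * pi) else 0)) =
        (\<Sum>i\<le>d. (?b i * cnj (?b i)) * of_real (2 * pi))"
      by (intro sum.cong) auto
    also have "\<dots> = of_real (2 * pi * (\<Sum>i\<le>d. (cmod (c i))\<^sup>2 * r ^ (2 * i)))"
      unfolding b by (simp add: sum_distrib_left mult_ac)
    finally show ?thesis .
  qed
  finally have "((\<lambda>t. of_real ((cmod (\<Sum>i\<le>d. c i * (of_real r * cis t) ^ i))\<^sup>2)) has_integral
      complex_of_real (2 * pi * (\<Sum>i\<le>d. (cmod (c i))\<^sup>2 * r ^ (2 * i)))) {0..2*pi}" .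
  from has_integral_linear[OF this bounded_linear_Re] show ?thesis by (simp add: o_def)
qed

text \<open>Carries the gauge integrals of Parseval's identity over to the extended integrals in
  which the means are stated.\<close>

lemma nn_integral_has_integral_on:
  fixes f :: "real \<Rightarrow> real"
  assumes "continuous_on UNIV f" "\<And>t. 0 \<le> f t" "(f has_integral I) S" "S \<in> sets borel"
  shows "(\<integral>\<^sup>+t\<in>S. ennreal (f t) \<partial>lborel) = ennreal I"
proof -
  have [measurable]: "f \<in> borel_measurable borel" "S \<in> sets borel"
    using assms borel_measurable_continuous_onI by auto
  have "(\<lambda>t. indicator S t * f t) = (\<lambda>t. if t \<in> S then f t else 0)"
    by auto
  hence "((\<lambda>t. indicator S t * f t) has_integral I) UNIV"
    using assms(3) has_integral_restrict_UNIV[of S f I] by metis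
  hence "(\<integral>\<^sup>+t. ennreal (indicator S t * f t) \<partial>lborel) = ennreal I"
    by (intro nn_integral_has_integral_lborel) (auto simp: assms)
  also have "(\<integral>\<^sup>+t. ennreal (indicator S t * f t) \<partial>lborel) = (\<integral>\<^sup>+t\<in>S. ennreal (f t) \<partial>lborel)"
    by (intro nn_integral_cong) (auto simp: indicator_def)
  finally show ?thesis .
qed

text \<open>The $2k$-th power mean of a polynomial $Q$ is the quadratic mean of $Q^k$, hence
  increasing in the radius by Parseval's identity.\<close>

lemma poly_circle_mean_mono:
  fixes Q :: "complex poly"
  assumes "0 \<le> r" "r \<le> 1"
  shows "(\<integral>\<^sup>+t\<in>{0..2*pi}. ennreal (cmod (poly Q (of_real r * cis t)) ^ (2 * k)) \<partial>lborel)
       \<le> (\<integral>\<^sup>+t\<in>{0..2*pi}. ennreal (cmod (poly Q (cis t)) ^ (2 * k)) \<partial>lborel)"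
proof -
  define P where "P = Q ^ k"
  \<comment> \<open>The radius is bound afresh here: the formula is used at the given
    \<open>r\<close> and at 1, where each term is at least as large.\<close>
  have *: "(\<integral>\<^sup>+t\<in>{0..2*pi}. ennreal (cmod (poly Q (of_real r * cis t)) ^ (2 * k)) \<partial>lborel) =
     ennreal (2 * pi * (\<Sum>i\<le>degree P. (cmod (coeff P i))\<^sup>2 * r ^ (2 * i)))" for r
  proof (rule nn_integral_has_integral_on)
    have "cmod (poly Q z) ^ (2 * k) = (cmod (\<Sum>i\<le>degree P. coeff P i * z ^ i))\<^sup>2" for z
      unfolding poly_altdef[symmetric] P_def by (simp add: norm_power power_mult[symmetric] mult.commute)
    thus "((\<lambda>t. cmod (poly Q (of_real r * cis t)) ^ (2 * k)) has_integral
        2 * pi * (\<Sum>i\<le>degree P. (cmod (coeff P i))\<^sup>2 * r ^ (2 * i))) {0..2*pi}"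
      using Parseval_poly[of "coeff P" r "degree P"] by simp
  qed (auto intro!: continuous_intros)
  have "(\<Sum>i\<le>degree P. (cmod (coeff P i))\<^sup>2 * r ^ (2 * i)) \<le>
        (\<Sum>i\<le>degree P. (cmod (coeff P i))\<^sup>2 * 1 ^ (2 * i))"
    using assms by (intro sum_mono mult_left_mono power_mono) auto
  thus ?thesis using *[of r] *[of 1] by (auto intro!: ennreal_leI mult_left_mono)
qed

text \<open>On the unit circle the full series may diverge, so the bound is in terms of partial
  sums. Fatou's lemma is applied at a radius below 1, where they converge; monotonicity in the
  radius then moves each polynomial out to the unit circle.\<close>

lemma hardy_size_even_le_liminf:
  assumes c: "1 \<le> conv_radius c" and k: "0 < k"
  shows "hardy_size (real (2 * k)) c \<le>
    liminf (\<lambda>N. \<integral>\<^sup>+t\<in>{0..2*pi}. ennreal (cmod (\<Sum>n<N. c n * cis t ^ n) ^ (2 * k)) \<partial>lborel)"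
    (is "_ \<le> liminf ?I")
proof -
  have "circle_mean (real (2 * k)) c r \<le> liminf ?I" if r: "r \<in> {0..<1}" for r
  proof -
    let ?S = "\<lambda>N z. \<Sum>n<N. c n * z ^ n"
    have "circle_mean (real (2 * k)) c r = (\<integral>\<^sup>+t. liminf (\<lambda>N.
        ennreal (cmod (?S N (of_real r * cis t)) ^ (2 * k)) * indicator {0..2*pi} t) \<partial>lborel)"
      unfolding circle_mean_def
    proof (intro nn_integral_cong)
      fix t
      let ?z = "of_real r * cis t"
      have "?z \<in> ball 0 1" using r by (simp add: norm_mult)
      from sums_in_disk[OF c this]
      have "(\<lambda>N. ?S N ?z) \<longlonglongrightarrow> (\<Sum>n. c n * ?z ^ n)" by (simp add: sums_def)
      hence "(\<lambda>N. ennreal (cmod (?S N ?z) ^ (2 * k)) * indicator {0..2*pi} t) \<longlonglongrightarrow>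
          ennreal (cmod (\<Sum>n. c n * ?z ^ n) ^ (2 * k)) * indicator {0..2*pi} t"
        by (auto simp: indicator_def intro!: tendsto_ennrealI tendsto_intros)
      from lim_imp_Liminf[OF _ this]
      have "liminf (\<lambda>N. ennreal (cmod (?S N ?z) ^ (2 * k)) * indicator {0..2*pi} t) =
          ennreal (cmod (\<Sum>n. c n * ?z ^ n) ^ (2 * k)) * indicator {0..2*pi} t" by simp
      \<comment> \<open>At base 0 and exponent 0, \<open>powr\<close> gives 0 while the power gives
        1; this is where \<open>0 < k\<close> enters.\<close>
      moreover have "cmod (\<Sum>n. c n * ?z ^ n) powr real (2 * k) = cmod (\<Sum>n. c n * ?z ^ n) ^ (2 * k)"
        using k by (intro powr_realpow') auto
      ultimately show "ennreal (cmod (\<Sum>n. c n * ?z ^ n) powr real (2 * k)) * indicator {0..2*pi} t =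
        liminf (\<lambda>N. ennreal (cmod (?S N ?z) ^ (2 * k)) * indicator {0..2*pi} t)"
        by simp
    qed
    also have "\<dots> \<le> liminf (\<lambda>N. \<integral>\<^sup>+t\<in>{0..2*pi}. ennreal (cmod (?S N (of_real r * cis t)) ^ (2 * k)) \<partial>lborel)"
    proof (intro nn_integral_liminf)
      fix N
      have [measurable]: "(\<lambda>t. cmod (?S N (of_real r * cis t)) ^ (2 * k)) \<in> borel_measurable borel"
        by (intro borel_measurable_continuous_onI continuous_intros)
      show "(\<lambda>t. ennreal (cmod (?S N (of_real r * cis t)) ^ (2 * k)) * indicator {0..2*pi} t)
          \<in> borel_measurable lborel" by measurable
    qed
    also have "\<dots> \<le> liminf ?I"
    proof (intro Liminf_mono always_eventually allI)
      fix N
      have "poly (\<Sum>n<N. monom (c n) n) z = ?S N z" for z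
        by (simp add: poly_sum poly_monom)
      thus "(\<integral>\<^sup>+t\<in>{0..2*pi}. ennreal (cmod (?S N (of_real r * cis t)) ^ (2 * k)) \<partial>lborel) \<le> ?I N"
        using poly_circle_mean_mono[of r "\<Sum>n<N. monom (c n) n" k] r by simp
    qed
    finally show ?thesis .
  qed
  thus ?thesis unfolding hardy_size_def using c by (auto intro!: SUP_least)
qed

text \<open>The pointwise bound \<open>x powr p \<le> 1 + x powr q\<close> is integrated over a set
  of finite measure. This reduces every \<open>p\<close> to an even exponent.\<close>

lemma hardy_size_mono_exponent:
  assumes p: "0 < p" "p \<le> q" and fin: "hardy_size q c < \<infinity>"
  shows "hardy_size p c < \<infinity>"
proof -
  have c: "1 \<le> conv_radius c" using fin by (auto simp: hardy_size_def split: if_splits)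
  have "circle_mean p c r \<le> ennreal (2 * pi) + hardy_size q c" if r: "r \<in> {0..<1}" for r
  proof -
    let ?F = "\<lambda>p t. cmod (\<Sum>n. c n * (of_real r * cis t) ^ n) powr p"
    have [measurable]: "?F q \<in> borel_measurable borel"
      using r p c by (auto intro!: borel_measurable_continuous_onI continuous_on_cmod_powr_circle)
    have "x powr p \<le> 1 + x powr q" if "0 \<le> x" for x :: real
    proof (cases "x \<le> 1")
      case True
      have "x powr p \<le> 1 powr p" using p True that by (intro powr_mono2) auto
      thus ?thesis by (simp add: add_increasing2)
    next
      case False
      have "x powr p \<le> x powr q" using p False by (intro powr_mono) auto
      thus ?thesis by simp
    qed
    hence "ennreal (?F p t) \<le> ennreal (1 + ?F q t)" for t
      by (intro ennreal_leI) simp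
    hence "ennreal (?F p t) \<le> 1 + ennreal (?F q t)" for t
      by (simp add: ennreal_plus)
    hence "circle_mean p c r \<le> (\<integral>\<^sup>+t. indicator {0..2*pi} t + ennreal (?F q t) * indicator {0..2*pi} t \<partial>lborel)"
      unfolding circle_mean_def by (intro nn_integral_mono) (auto simp: indicator_def)
    also have "\<dots> = ennreal (2 * pi) + circle_mean q c r"
      unfolding circle_mean_def by (subst nn_integral_add) auto
    also have "\<dots> \<le> ennreal (2 * pi) + hardy_size q c"
      using r p by (intro add_left_mono circle_mean_le_hardy_size c) auto
    finally show ?thesis .
  qed
  hence "hardy_size p c \<le> ennreal (2 * pi) + hardy_size q c"
    unfolding hardy_size_def[of p] using c by (auto intro!: SUP_least)
  also have "\<dots> < \<infinity>" using fin by simp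
  finally show ?thesis .
qed

lemma hardy_size_uminus: "hardy_size p (\<lambda>n. - c n) = hardy_size p c"
proof -
  have r: "conv_radius (\<lambda>n. - c n) = conv_radius c"
    using conv_radius_norm[of "\<lambda>n. - c n"] conv_radius_norm[of c] by simp
  have "circle_mean p (\<lambda>n. - c n) s = circle_mean p c s" if "1 \<le> conv_radius c" "s \<in> {0..<1}" for s
  proof -
    have "(\<Sum>n. - c n * (of_real s * cis t) ^ n) = - (\<Sum>n. c n * (of_real s * cis t) ^ n)" for t
      using suminf_minus[OF summable_in_disk[OF that(1), of "of_real s * cis t"]] that(2)
      by (simp add: norm_mult)
    thus ?thesis by (simp add: circle_mean_def)
  qed
  thus ?thesis unfolding hardy_size_def r by (auto intro!: SUP_cong)
qed

text \<open>On radius \<open>r\<close> the monomial has constant modulus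
  \<open>cmod d * r ^ n\<close>; letting \<open>r\<close> tend to 1 removes \<open>n\<close>, so the
  bound is uniform in the position of the coefficient.\<close>

lemma hardy_size_monomial_ge:
  assumes p: "0 < p"
  shows "ennreal (2 * pi * cmod d powr p) \<le> hardy_size p (\<lambda>m. if m = n then d else 0)"
proof -
  let ?c = "\<lambda>m. if m = n then d else 0"
  have sums: "(\<lambda>m. ?c m * z ^ m) sums (d * z ^ n)" for z
    using sums_single[of n "\<lambda>m. d * z ^ m"] by (simp add: if_distrib[of "\<lambda>x. x * _"] cong: if_cong)
  hence c: "1 \<le> conv_radius ?c"
    unfolding one_le_conv_radius_iff by (auto simp: sums_iff)
  have "((\<lambda>r. ennreal (2 * pi * (cmod d * r ^ n) powr p)) \<longlongrightarrow>
      ennreal (2 * pi * (cmod d * 1 ^ n) powr p)) (at_left 1)"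
  proof (intro tendsto_ennrealI tendsto_mult tendsto_const tendsto_powr2)
    show "\<forall>\<^sub>F r in at_left (1::real). 0 \<le> cmod d * r ^ n"
      using eventually_at_left_real[of 0 1] by (auto elim!: eventually_mono)
    show "((\<lambda>r. r ^ n) \<longlongrightarrow> 1 ^ n) (at_left (1::real))"
      by (intro tendsto_intros)
  qed (rule p)
  moreover have "\<forall>\<^sub>F r in at_left 1. ennreal (2 * pi * (cmod d * r ^ n) powr p) \<le> hardy_size p ?c"
  proof -
    have "ennreal (2 * pi * (cmod d * r ^ n) powr p) \<le> hardy_size p ?c" if r: "r \<in> {0<..<1}" for r
    proof -
      have "cmod (\<Sum>m. ?c m * (of_real r * cis t) ^ m) = cmod d * r ^ n" for t
        unfolding sums_unique[OF sums, symmetric] using r by (simp add: norm_mult norm_power)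
      hence "circle_mean p ?c r = (\<integral>\<^sup>+t\<in>{0..2*pi}. ennreal ((cmod d * r ^ n) powr p) \<partial>lborel)"
        unfolding circle_mean_def by simp
      also have "\<dots> = ennreal (2 * pi * (cmod d * r ^ n) powr p)"
        by (simp add: nn_integral_cmult_indicator ennreal_mult' [symmetric] mult.commute)
      finally show ?thesis using circle_mean_le_hardy_size[OF c _ _ p, of r] r by simp
    qed
    thus ?thesis
      using eventually_at_left_real[of 0 1] by (auto elim!: eventually_mono)
  qed
  ultimately have "ennreal (2 * pi * (cmod d * 1 ^ n) powr p) \<le> hardy_size p ?c"
    by (rule tendsto_upperbound) auto
  thus ?thesis by simp
qed

section \<open>Square-summable coefficient sequences\<close>

lemma conv_radius_H2:
  assumes "c \<in> H2_coeffs"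
  shows "1 \<le> conv_radius c"
proof (rule conv_radius_geI_ex')
  fix r :: real assume r: "0 < r" "ereal r < 1"
  \<comment> \<open>The majorant comes from \<open>2 * x * y \<le> x\<^sup>2 + y\<^sup>2\<close>
    with \<open>x = cmod (c n)\<close> and \<open>y = r ^ n\<close>.\<close>
  have "summable (\<lambda>n. (cmod (c n))\<^sup>2 + (r\<^sup>2) ^ n)"
    using assms r by (intro summable_add) (auto simp: H2_coeffs_def power_less_one_iff abs_square_less_1 one_ereal_def)
  moreover have "norm (c n * of_real r ^ n) \<le> (cmod (c n))\<^sup>2 + (r\<^sup>2) ^ n" for n
  proof -
    have "norm (c n * of_real r ^ n) = cmod (c n) * r ^ n" using r by (simp add: norm_mult norm_power)
    also have "\<dots> \<le> 2 * cmod (c n) * r ^ n" using r by simp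
    also have "\<dots> \<le> (cmod (c n))\<^sup>2 + (r ^ n)\<^sup>2" by (rule sum_squares_bound)
    finally show ?thesis by (simp add: power_mult[symmetric] mult.commute)
  qed
  ultimately show "summable (\<lambda>n. c n * of_real r ^ n)"
    by (intro summable_comparison_test[of "\<lambda>n. c n * of_real r ^ n"]) auto
qed

text \<open>A gliding-hump argument: if \<open>s\<close> were unbounded, a sparse square-summable
  \<open>a\<close> supported where \<open>s\<close> is huge would make the products
  unbounded.\<close>

lemma bounded_if_H2_products_bounded:
  fixes s :: "nat \<Rightarrow> real"
  assumes nonneg: "\<And>n. 0 \<le> s n"
    and *: "\<And>a. a \<in> H2_coeffs \<Longrightarrow> \<exists>C. \<forall>n. cmod (a n) * s n \<le> C"
  shows "bounded (range s)"
proof (rule ccontr)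
  assume unb: "\<not> bounded (range s)"
  \<comment> \<open>Only finitely many indices are at most \<open>m\<close>, so an unbounded
    \<open>s\<close> is large at arbitrarily late indices.\<close>
  have ex: "\<exists>n>m. B \<le> s n" for B m
  proof (rule ccontr)
    assume "\<not> (\<exists>n>m. B \<le> s n)"
    hence "s n \<le> max B (Max (s ` {..m}))" for n
      by (cases "n \<le> m") (auto simp: le_max_iff_disj not_le intro: less_imp_le)
    hence "bounded (range s)"
      using nonneg by (intro boundedI) auto
    thus False using unb by simp
  qed
  \<comment> \<open>Weights \<open>(1 / 2) ^ k\<close> on indices with
    \<open>s (g k) \<ge> 4 ^ k\<close> have summable squares, while the products are at least
    \<open>2 ^ k\<close>.\<close>
  have "\<exists>g. \<forall>k::nat. 4 ^ k \<le> s (g k) \<and> g k < g (Suc k)"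
    by (rule dependent_nat_choice) (use ex in \<open>auto simp: conj_commute\<close>)
  then obtain g where g: "\<And>k. 4 ^ k \<le> s (g k)" "strict_mono g"
    by (auto simp: strict_mono_Suc_iff)
  define a :: "nat \<Rightarrow> complex" where
    "a n = (if n \<in> range g then (1 / 2) ^ inv g n else 0)" for n
  have ag: "a (g k) = (1 / 2) ^ k" for k
    using g(2) by (simp add: a_def strict_mono_imp_inj_on)
  have "(cmod (a (g k)))\<^sup>2 = (1 / 4) ^ k" for k
  proof -
    have "(cmod (a (g k)))\<^sup>2 = ((1 / 2) ^ k)\<^sup>2" by (simp add: ag norm_power norm_divide)
    also have "\<dots> = ((1 / 2)\<^sup>2) ^ k" by (simp only: power_mult[symmetric] mult.commute)
    finally show ?thesis by (simp add: power2_eq_square)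
  qed
  hence "summable (\<lambda>k. (cmod (a (g k)))\<^sup>2)" by (simp add: summable_geometric)
  hence "a \<in> H2_coeffs"
    unfolding H2_coeffs_def by (subst (asm) summable_mono_reindex[OF g(2)]) (auto simp: a_def)
  then obtain C where C: "\<And>n. cmod (a n) * s n \<le> C" using * by blast
  obtain k where "C < 2 ^ k" using real_arch_pow[of 2 C] by auto
  also have "(2::real) ^ k = (1 / 2) ^ k * 4 ^ k" by (simp flip: power_mult_distrib)
  also have "\<dots> \<le> (1 / 2) ^ k * s (g k)" using g by (intro mult_left_mono) auto
  also have "\<dots> \<le> C" using C[of "g k"] by (simp add: ag norm_power norm_divide)
  finally show False by simp
qed

section \<open>Gaussian laws\<close>

text \<open>Completing the square: tilting the density by \<open>exp (b * (x - m))\<close> shifts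
  the mean to \<open>m + b * s\<^sup>2\<close> and leaves a constant factor. For
  \<open>s = 0\<close> both sides are 1.\<close>

lemma nn_integral_exp_gaussian_law:
  assumes "0 \<le> s"
  shows "(\<integral>\<^sup>+x. ennreal (exp (b * (x - m))) \<partial>gaussian_law m s) = ennreal (exp (b\<^sup>2 * s\<^sup>2 / 2))"
proof (cases "s = 0")
  case True
  thus ?thesis by (simp add: gaussian_law_def nn_integral_return)
next
  case False
  with assms have s: "0 < s" by simp
  interpret N: prob_space "density lborel (normal_density (m + b * s\<^sup>2) s)"
    using s by (rule prob_space_normal_density)
  have N: "(\<integral>\<^sup>+x. ennreal (normal_density (m + b * s\<^sup>2) s x) \<partial>lborel) = 1"
    using N.emeasure_space_1 by (simp add: emeasure_density)
  have eq: "normal_density m s x * exp (b * (x - m)) =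
      exp (b\<^sup>2 * s\<^sup>2 / 2) * normal_density (m + b * s\<^sup>2) s x" for x
  proof -
    have "- (x - m)\<^sup>2 / (2 * s\<^sup>2) + b * (x - m) = b\<^sup>2 * s\<^sup>2 / 2 + - (x - (m + b * s\<^sup>2))\<^sup>2 / (2 * s\<^sup>2)"
      using s by (simp add: field_simps power2_eq_square)
    hence "exp (- (x - m)\<^sup>2 / (2 * s\<^sup>2)) * exp (b * (x - m)) =
        exp (b\<^sup>2 * s\<^sup>2 / 2) * exp (- (x - (m + b * s\<^sup>2))\<^sup>2 / (2 * s\<^sup>2))"
      by (simp only: exp_add[symmetric])
    thus ?thesis by (simp add: normal_density_def)
  qed
  have "(\<integral>\<^sup>+x. ennreal (exp (b * (x - m))) \<partial>gaussian_law m s) =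
      (\<integral>\<^sup>+x. ennreal (exp (b\<^sup>2 * s\<^sup>2 / 2)) * ennreal (normal_density (m + b * s\<^sup>2) s x) \<partial>lborel)"
    using s by (simp add: gaussian_law_def nn_integral_density ennreal_mult'[symmetric] eq)
  also have "\<dots> = ennreal (exp (b\<^sup>2 * s\<^sup>2 / 2))"
    by (subst nn_integral_cmult) (auto simp: N)
  finally show ?thesis .
qed

text \<open>The map is affine with slope -1: it sends the mean to \<open>2 * m - m\<close> and
  multiplies the deviation by the absolute value of the slope.\<close>

lemma distr_reflect_gaussian_law:
  assumes "0 \<le> s"
  shows "distr (gaussian_law m s) borel (\<lambda>x. 2 * m - x) = gaussian_law m s"
proof (cases "s = 0")
  case True
  thus ?thesis by (simp add: gaussian_law_def distr_return)
next
  case False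
  with assms have s: "0 < s" by simp
  interpret N: prob_space "density lborel (normal_density m s)"
    using s by (rule prob_space_normal_density)
  have "distributed (density lborel (normal_density m s)) lborel (\<lambda>x. x) (normal_density m s)"
    unfolding distributed_def by (auto intro!: distr_id2)
  from N.normal_density_affine[OF this s, of "-1" "2 * m"]
  have "distr (density lborel (normal_density m s)) lborel (\<lambda>x. 2 * m - x) =
      density lborel (normal_density m s)"
    by (simp add: distributed_def)
  moreover have "distr (density lborel (normal_density m s)) lborel (\<lambda>x. 2 * m - x) =
    distr (density lborel (normal_density m s)) borel (\<lambda>x. 2 * m - x)"
    by (rule distr_cong) auto
  ultimately show ?thesis using s by (simp add: gaussian_law_def)
qed

text \<open>The density is at most \<open>1 / (2 * s)\<close>, because
  \<open>sqrt (2 * pi) \<ge> 2\<close>, and the interval has length \<open>2 * e\<close>. This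
  anticoncentration later turns a lower bound on a probability into an upper bound on the
  deviation.\<close>

lemma emeasure_gaussian_law_small_ball:
  assumes s: "0 < s" and e: "0 \<le> e"
  shows "emeasure (gaussian_law m s) {x. \<bar>x - m\<bar> \<le> e} \<le> ennreal (e / s)"
proof -
  have eq: "{x. \<bar>x - m\<bar> \<le> e} = {m - e..m + e}" by auto
  have "normal_density m s x \<le> 1 / (2 * s)" for x
  proof -
    have "2 * s = sqrt ((2 * s)\<^sup>2)" using s by (subst real_sqrt_abs) simp
    also have "\<dots> \<le> sqrt (2 * pi * s\<^sup>2)"
      using s pi_ge_two by (intro real_sqrt_le_mono) (simp add: power2_eq_square mult_right_mono)
    finally have "1 / sqrt (2 * pi * s\<^sup>2) \<le> 1 / (2 * s)"
      using s by (intro divide_left_mono) auto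
    moreover have "exp (- (x - m)\<^sup>2 / (2 * s\<^sup>2)) \<le> 1" by simp
    ultimately have "1 / sqrt (2 * pi * s\<^sup>2) * exp (- (x - m)\<^sup>2 / (2 * s\<^sup>2)) \<le> 1 / (2 * s) * 1"
      using s by (intro mult_mono) auto
    thus ?thesis by (simp add: normal_density_def)
  qed
  hence "(\<integral>\<^sup>+x. ennreal (normal_density m s x) * indicator {m - e..m + e} x \<partial>lborel) \<le>
     (\<integral>\<^sup>+x. ennreal (1 / (2 * s)) * indicator {m - e..m + e} x \<partial>lborel)"
    by (intro nn_integral_mono mult_right_mono ennreal_leI) auto
  also have "\<dots> = ennreal (1 / (2 * s)) * ennreal (2 * e)"
    using e by (simp add: nn_integral_cmult_indicator)
  also have "\<dots> = ennreal (e / s)"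
    using s e by (simp add: ennreal_mult'[symmetric])
  finally show ?thesis
    using s by (simp add: gaussian_law_def eq emeasure_density)
qed

text \<open>\<open>gaussian_rv\<close> only asserts that some parameters exist; mean and variance
  identify them, with \<open>0 \<le> s\<close> selecting the root. The point mass is treated apart,
  as it has no density.\<close>

lemma (in prob_space) distr_eq_gaussian_law:
  assumes "gaussian_rv M Y" "expectation Y = m" "variance Y = s\<^sup>2" "0 \<le> s"
  shows "distr M borel Y = gaussian_law m s"
proof -
  have [measurable]: "Y \<in> borel_measurable M" using assms by (simp add: gaussian_rv_def)
  obtain m' s' where ms: "0 \<le> s'" "distr M borel Y = gaussian_law m' s'"
    using assms(1) by (auto simp: gaussian_rv_def)
  have "m' = m \<and> s' = s"
  proof (cases "s' = 0")
    case True
    have "expectation Y = integral\<^sup>L (distr M borel Y) (\<lambda>x. x)"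
      by (subst integral_distr) auto
    also have "\<dots> = m'" using True by (simp add: ms gaussian_law_def integral_return)
    finally have m: "expectation Y = m'" .
    have "variance Y = integral\<^sup>L (distr M borel Y) (\<lambda>x. (x - m')\<^sup>2)"
      by (subst integral_distr) (auto simp: m)
    also have "\<dots> = 0" using True by (simp add: ms gaussian_law_def integral_return)
    finally show ?thesis using assms True m by simp
  next
    case False
    hence s': "0 < s'" using ms by simp
    have "distr M lborel Y = distr M borel Y" by (rule distr_cong) auto
    hence "distributed M lborel Y (normal_density m' s')"
      using ms(2) s' by (auto simp: distributed_def gaussian_law_def)
    from normal_distributed_expectation[OF s' this] normal_distributed_variance[OF s' this]
    show ?thesis using assms s' by auto
  qed
  thus ?thesis using ms by simp
qed

lemma power_even_le_exp:
  fixes y :: real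
  shows "y ^ (2 * k) \<le> fact (2 * k) * (exp y + exp (- y))"
proof -
  \<comment> \<open>A single term of the exponential series is at most the whole sum, since all
    terms are nonnegative at \<open>\<bar>y\<bar>\<close>.\<close>
  have "\<bar>y\<bar> ^ (2 * k) / fact (2 * k) \<le> exp \<bar>y\<bar>"
  proof -
    have "sum (\<lambda>n. \<bar>y\<bar> ^ n /\<^sub>R fact n) {2 * k} \<le> (\<Sum>n. \<bar>y\<bar> ^ n /\<^sub>R fact n)"
      by (intro sum_le_suminf summable_exp_generic) auto
    thus ?thesis by (simp add: exp_def divide_inverse mult.commute)
  qed
  also have "\<dots> \<le> exp y + exp (- y)" by (cases "0 \<le> y") auto
  finally have "\<bar>y\<bar> ^ (2 * k) \<le> fact (2 * k) * (exp y + exp (- y))" by (simp add: field_simps)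
  thus ?thesis by (simp add: power_even_abs)
qed

lemma cmod_power_even_le:
  "cmod w ^ (2 * k) \<le> 2 ^ k * (Re w ^ (2 * k) + Im w ^ (2 * k))"
proof -
  have "cmod w ^ (2 * k) = ((Re w)\<^sup>2 + (Im w)\<^sup>2) ^ k"
    by (simp add: power_mult cmod_power2)
  also have "\<dots> \<le> (2 * max ((Re w)\<^sup>2) ((Im w)\<^sup>2)) ^ k"
    by (intro power_mono) auto
  also have "\<dots> = 2 ^ k * max ((Re w)\<^sup>2) ((Im w)\<^sup>2) ^ k" by (rule power_mult_distrib)
  also have "\<dots> \<le> 2 ^ k * (Re w ^ (2 * k) + Im w ^ (2 * k))"
    by (intro mult_left_mono) (auto simp: max_def power_mult)
  finally show ?thesis .
qed

text \<open>A function of the real sequence \<open>x\<close> alone, measurable on the product space,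
  so that its law depends only on the joint law of the sequence inserted.\<close>

definition size_of :: "real \<Rightarrow> (nat \<Rightarrow> complex) \<Rightarrow> (nat \<Rightarrow> real) \<Rightarrow> ennreal" where
  "size_of p a x = hardy_size p (\<lambda>n. a n * complex_of_real (x n))"

lemma size_of_measurable [measurable]:
  "size_of p a \<in> borel_measurable (\<Pi>\<^sub>M n\<in>UNIV. borel)"
  unfolding size_of_def by measurable

section \<open>Sequences of independent Gaussian variables\<close>

locale gaussian_sequence = prob_space M for M :: "'a measure" +
  fixes X :: "nat \<Rightarrow> 'a \<Rightarrow> real" and \<mu> \<sigma> :: "nat \<Rightarrow> real"
  assumes indep: "indep_vars (\<lambda>_. borel) X UNIV"
    and distr_X: "distr M borel (X n) = gaussian_law (\<mu> n) (\<sigma> n)"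
    and sigma_nonneg: "0 \<le> \<sigma> n"
begin

section \<open>Reflected sequences and their joint law\<close>

lemma X_measurable [measurable]: "X n \<in> borel_measurable M"
  using indep by (auto simp: indep_vars_def)

text \<open>The choice \<open>J = {}\<close> gives back the original sequence, so one statement
  about all \<open>J\<close> suffices to compare the laws.\<close>

definition reflected :: "nat set \<Rightarrow> 'a \<Rightarrow> nat \<Rightarrow> real" where
  "reflected J \<omega> n = (if n \<in> J then 2 * \<mu> n - X n \<omega> else X n \<omega>)"

lemma reflected_measurable [measurable]:
  "reflected J \<in> M \<rightarrow>\<^sub>M (\<Pi>\<^sub>M n\<in>UNIV. borel)"
  "(\<lambda>\<omega>. reflected J \<omega> n) \<in> borel_measurable M"
proof -
  show *: "(\<lambda>\<omega>. reflected J \<omega> n) \<in> borel_measurable M" for n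
    unfolding reflected_def by measurable
  show "reflected J \<in> M \<rightarrow>\<^sub>M (\<Pi>\<^sub>M n\<in>UNIV. borel)"
    by (rule measurable_PiM_single') (use * in auto)
qed

text \<open>Coordinatewise maps preserve independence, so the joint law is the product of the
  marginals, and each marginal is symmetric about its mean. The right-hand side does not depend on
  \<open>J\<close>.\<close>

lemma distr_reflected:
  "distr M (\<Pi>\<^sub>M n\<in>UNIV. borel) (reflected J) = (\<Pi>\<^sub>M n\<in>UNIV. gaussian_law (\<mu> n) (\<sigma> n))"
proof -
  let ?R = "\<lambda>n \<omega>. reflected J \<omega> n"
  have "indep_vars (\<lambda>_. borel) ?R UNIV"
    unfolding reflected_def
    by (rule indep_vars_compose2[OF indep, of "\<lambda>n x. if n \<in> J then 2 * \<mu> n - x else x"]) auto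
  hence "distr M (\<Pi>\<^sub>M n\<in>UNIV. borel) (\<lambda>\<omega>. \<lambda>n\<in>UNIV. ?R n \<omega>) = (\<Pi>\<^sub>M n\<in>UNIV. distr M borel (?R n))"
    by (subst (asm) indep_vars_iff_distr_eq_PiM') auto
  moreover have "distr M borel (?R n) = gaussian_law (\<mu> n) (\<sigma> n)" for n
  proof (cases "n \<in> J")
    case True
    have "distr M borel (?R n) = distr (distr M borel (X n)) borel (\<lambda>x. 2 * \<mu> n - x)"
      using True by (subst distr_distr) (auto simp: reflected_def o_def)
    thus ?thesis by (simp add: distr_X distr_reflect_gaussian_law sigma_nonneg)
  next
    case False
    thus ?thesis using distr_X by (simp add: reflected_def)
  qed
  ultimately show ?thesis by (simp add: restrict_def)
qed

lemma emeasure_size_of_reflected: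
  assumes [measurable]: "A \<in> sets borel"
  shows "emeasure M {\<omega>\<in>space M. size_of p a (reflected J \<omega>) \<in> A} =
         emeasure M {\<omega>\<in>space M. size_of p a (\<lambda>n. X n \<omega>) \<in> A}"
proof -
  let ?P = "PiM (UNIV :: nat set) (\<lambda>_. borel :: real measure)"
  let ?B = "{x\<in>space ?P. size_of p a x \<in> A}"
  have [measurable]: "?B \<in> sets ?P" by measurable
  have *: "emeasure M {\<omega>\<in>space M. size_of p a (reflected J \<omega>) \<in> A} = emeasure (distr M ?P (reflected J)) ?B" for J
  proof -
    have "reflected J -` ?B \<inter> space M = {\<omega>\<in>space M. size_of p a (reflected J \<omega>) \<in> A}"
      by (auto simp: space_PiM)
    thus ?thesis by (subst emeasure_distr) measurable
  qed
  have "(\<lambda>n. X n \<omega>) = reflected {} \<omega>" for \<omega>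
    by (simp add: reflected_def fun_eq_iff)
  thus ?thesis using *[of J] *[of "{}"] by (simp add: distr_reflected)
qed

section \<open>Necessity of the two conditions\<close>

lemma L_property_iff:
  assumes "0 < p"
  shows "L_property M p (\<lambda>n \<omega>. complex_of_real (X n \<omega>)) \<longleftrightarrow>
    (\<forall>a\<in>H2_coeffs. AE \<omega> in M. size_of p a (\<lambda>n. X n \<omega>) < \<infinity>)"
  unfolding L_property_def size_of_def using series_in_hardy_iff[OF assms] by simp

lemma mean_multiplier_if_L_property:
  assumes p: "0 < p" and L: "L_property M p (\<lambda>n \<omega>. complex_of_real (X n \<omega>))"
  shows "H2_multiplier p (\<lambda>n. complex_of_real (\<mu> n))"
  unfolding H2_multiplier_def
proof
  fix a assume "a \<in> H2_coeffs"
  \<comment> \<open>Halving compensates for the sum of \<open>X n \<omega>\<close> and its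
    reflection being \<open>2 * \<mu> n\<close>.\<close>
  hence "(\<lambda>n. a n / 2) \<in> H2_coeffs"
    by (simp add: H2_coeffs_def norm_divide power_divide summable_divide)
  hence 1: "AE \<omega> in M. size_of p (\<lambda>n. a n / 2) (\<lambda>n. X n \<omega>) < \<infinity>"
    using L unfolding L_property_iff[OF p] by blast
  have [measurable]: "(\<lambda>\<omega> n. X n \<omega>) \<in> M \<rightarrow>\<^sub>M (\<Pi>\<^sub>M n\<in>UNIV. borel)"
    by (rule measurable_PiM_single') auto
  \<comment> \<open>Almost sure finiteness is phrased as nullity of the event with value infinity,
    the form in which equality of laws transfers it.\<close>
  have "emeasure M {\<omega>\<in>space M. size_of p (\<lambda>n. a n / 2) (\<lambda>n. X n \<omega>) \<in> {\<infinity>}} = 0"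
    using 1 by (subst (asm) AE_iff_measurable[OF _ refl]) (auto simp: not_less top_unique)
  hence "emeasure M {\<omega>\<in>space M. size_of p (\<lambda>n. a n / 2) (reflected UNIV \<omega>) \<in> {\<infinity>}} = 0"
    by (subst emeasure_size_of_reflected) auto
  hence 2: "AE \<omega> in M. size_of p (\<lambda>n. a n / 2) (reflected UNIV \<omega>) < \<infinity>"
    by (subst AE_iff_measurable[OF _ refl]) (auto simp: not_less top_unique)
  have "AE \<omega> in M. hardy_size p (\<lambda>n. a n * complex_of_real (\<mu> n)) < \<infinity>"
    using 1 2
  proof eventually_elim
    case (elim \<omega>)
    have "hardy_size p (\<lambda>n. a n * complex_of_real (\<mu> n)) =
        hardy_size p (\<lambda>n. a n / 2 * complex_of_real (X n \<omega>) + a n / 2 * complex_of_real (reflected UNIV \<omega> n))"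
      by (simp add: reflected_def algebra_simps)
    also have "\<dots> \<le> ennreal (2 powr p) * (size_of p (\<lambda>n. a n / 2) (\<lambda>n. X n \<omega>) +
        size_of p (\<lambda>n. a n / 2) (reflected UNIV \<omega>))"
      unfolding size_of_def by (rule hardy_size_add_le[OF p])
    also have "\<dots> < \<infinity>"
      using elim by (simp add: ennreal_mult_less_top)
    finally show ?case .
  qed
  \<comment> \<open>The property obtained does not involve \<open>\<omega>\<close>, so holding
    almost surely in a probability space means holding.\<close>
  thus "series_in_hardy p (\<lambda>n. a n * complex_of_real (\<mu> n))"
    by (simp add: series_in_hardy_iff[OF p])
qed

text \<open>One level \<open>B\<close> is exceeded only with small probability, both by the original
  size and by the size after reflecting any single coordinate, since the laws agree. This is the
  source of uniformity in \<open>n\<close>.\<close>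

lemma coefficient_bound_if_AE_finite:
  assumes p: "0 < p" and fin: "AE \<omega> in M. size_of p a (\<lambda>n. X n \<omega>) < \<infinity>"
  shows "\<exists>C. \<forall>n. cmod (a n) * \<sigma> n \<le> C"
proof -
  have [measurable]: "(\<lambda>\<omega> n. X n \<omega>) \<in> M \<rightarrow>\<^sub>M (\<Pi>\<^sub>M n\<in>UNIV. borel)"
    by (rule measurable_PiM_single') auto
  define E where "E B = {\<omega>\<in>space M. size_of p a (\<lambda>n. X n \<omega>) \<in> {..of_nat B}}" for B :: nat
  have [measurable]: "E B \<in> events" for B unfolding E_def by measurable
  have "(\<lambda>B. prob (E B)) \<longlonglongrightarrow> prob (\<Union>B. E B)"
    by (rule finite_Lim_measure_incseq) (auto simp: E_def incseq_def intro: order.trans)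
  also have "prob (\<Union>B. E B) = 1"
  proof (subst prob_eq_1)
    show "AE \<omega> in M. \<omega> \<in> (\<Union>B. E B)"
      using fin AE_space
    proof eventually_elim
      case (elim \<omega>)
      then obtain x where x: "size_of p a (\<lambda>n. X n \<omega>) = ennreal x" "0 \<le> x"
        by (cases "size_of p a (\<lambda>n. X n \<omega>)") auto
      obtain B where "x \<le> real B" using real_arch_simple by blast
      hence "ennreal x \<le> of_nat B"
        by (simp add: ennreal_of_nat_eq_real_of_nat ennreal_leI)
      thus ?case using x elim by (auto simp: E_def)
    qed
  qed auto
  \<comment> \<open>Two events of probability above 3/4 intersect with probability above
    1/2.\<close>
  finally have "\<forall>\<^sub>F B in sequentially. 3 / 4 < prob (E B)"
    by (rule order_tendstoD) simp
  then obtain B where B: "3 / 4 < prob (E B)"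
    by (auto simp: eventually_sequentially)
  \<comment> \<open>\<open>K\<close> is the bound that \<open>hardy_size_add_le\<close> gives for
    two sizes of at most \<open>B\<close>, and \<open>C\<close> solves
    \<open>2 * pi * C powr p = K\<close>.\<close>
  define K where "K = 2 powr p * (2 * real B)"
  define C where "C = (K / (2 * pi)) powr (1 / p)"
  have "cmod (a n) * \<sigma> n \<le> C" for n
  proof (cases "cmod (a n) * \<sigma> n > 0")
    case True
    hence an: "0 < cmod (a n)" and sn: "0 < \<sigma> n"
      using sigma_nonneg[of n] by (auto simp: zero_less_mult_iff)
    define E' where "E' = {\<omega>\<in>space M. size_of p a (reflected {n} \<omega>) \<in> {..of_nat B}}"
    have [measurable]: "E' \<in> events" unfolding E'_def by measurable
    have "prob E' = prob (E B)"
      unfolding E'_def E_def measure_def by (subst emeasure_size_of_reflected) auto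
    hence "1 / 2 < prob (E B \<inter> E')"
      using B measure_Un3[of "E B" M E'] prob_le_1[of "E B \<union> E'"] by (auto simp: fmeasurable_eq_sets)
    also have "\<dots> \<le> prob {\<omega>\<in>space M. \<bar>X n \<omega> - \<mu> n\<bar> \<le> C / (2 * cmod (a n))}"
    proof (intro finite_measure_mono subsetI CollectI conjI)
      fix \<omega> assume \<omega>: "\<omega> \<in> E B \<inter> E'"
      thus "\<omega> \<in> space M" by (auto simp: E_def)
      define d where "d = 2 * a n * complex_of_real (X n \<omega> - \<mu> n)"
      have "ennreal (2 * pi * cmod d powr p) \<le> hardy_size p (\<lambda>m. if m = n then d else 0)"
        by (rule hardy_size_monomial_ge[OF p])
      \<comment> \<open>All coordinates other than \<open>n\<close> cancel in the difference, which
        leaves a monomial.\<close>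
      also have "(\<lambda>m. if m = n then d else 0) = (\<lambda>m. a m * complex_of_real (X m \<omega>) +
          - (a m * complex_of_real (reflected {n} \<omega> m)))"
        by (auto simp: d_def reflected_def algebra_simps)
      also have "hardy_size p \<dots> \<le> ennreal (2 powr p) * (size_of p a (\<lambda>n. X n \<omega>) +
          size_of p a (reflected {n} \<omega>))"
        unfolding size_of_def using hardy_size_add_le[OF p]
        by (subst (3) hardy_size_uminus[symmetric])
      also have "\<dots> \<le> ennreal (2 powr p) * (of_nat B + of_nat B)"
        using \<omega> by (intro mult_left_mono add_mono) (auto simp: E_def E'_def)
      also have "\<dots> = ennreal K"
        by (simp add: K_def ennreal_of_nat_eq_real_of_nat ennreal_mult flip: ennreal_plus)
      finally have "2 * pi * cmod d powr p \<le> K"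
        by (simp add: K_def)
      hence "(cmod d powr p) powr (1 / p) \<le> C"
        unfolding C_def using p by (intro powr_mono2) (auto simp: field_simps)
      hence "cmod d \<le> C" using p by (simp add: powr_powr)
      hence "2 * cmod (a n) * \<bar>X n \<omega> - \<mu> n\<bar> \<le> C"
        by (simp add: d_def norm_mult flip: of_real_diff)
      thus "\<bar>X n \<omega> - \<mu> n\<bar> \<le> C / (2 * cmod (a n))"
        using an by (simp add: field_simps)
    qed measurable
    also have "\<dots> = measure (distr M borel (X n)) {x. \<bar>x - \<mu> n\<bar> \<le> C / (2 * cmod (a n))}"
      by (subst measure_distr) (auto intro!: arg_cong[where f = prob])
    also have "\<dots> \<le> C / (2 * cmod (a n)) / \<sigma> n"
    proof -
      have "0 \<le> C / (2 * cmod (a n)) / \<sigma> n" using sn by (simp add: C_def)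
      thus ?thesis
        using emeasure_gaussian_law_small_ball[OF sn, of "C / (2 * cmod (a n))" "\<mu> n"]
        unfolding distr_X measure_def by (intro enn2real_leI) (auto simp: C_def)
    qed
    \<comment> \<open>The chain reads \<open>1 / 2 < C / (2 * cmod (a n)) / \<sigma> n\<close>,
      which rearranges to the claim.\<close>
    finally show ?thesis using an sn by (simp add: field_simps)
  next
    case False
    moreover have "0 \<le> C" by (simp add: C_def)
    ultimately show ?thesis by linarith
  qed
  thus ?thesis by blast
qed

lemma bounded_sigma_if_L_property:
  assumes p: "0 < p" and L: "L_property M p (\<lambda>n \<omega>. complex_of_real (X n \<omega>))"
  shows "bounded (range \<sigma>)"
  using sigma_nonneg coefficient_bound_if_AE_finite[OF p] L
  unfolding L_property_iff[OF p] by (intro bounded_if_H2_products_bounded) auto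

section \<open>Sufficiency through moments of Gaussian sums\<close>

lemma nn_integral_exp_sum:
  "(\<integral>\<^sup>+\<omega>. ennreal (exp (\<Sum>n<N. b n * (X n \<omega> - \<mu> n))) \<partial>M) =
   ennreal (exp ((\<Sum>n<N. (b n)\<^sup>2 * (\<sigma> n)\<^sup>2) / 2))"
proof -
  have "indep_vars (\<lambda>_. borel) (\<lambda>n \<omega>. ennreal (exp (b n * (X n \<omega> - \<mu> n)))) {..<N}"
    by (rule indep_vars_compose2[OF indep_vars_subset[OF indep]]) auto
  hence "(\<integral>\<^sup>+\<omega>. (\<Prod>n<N. ennreal (exp (b n * (X n \<omega> - \<mu> n)))) \<partial>M) =
     (\<Prod>n<N. \<integral>\<^sup>+\<omega>. ennreal (exp (b n * (X n \<omega> - \<mu> n))) \<partial>M)"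
    by (intro indep_vars_nn_integral) auto
  also have "\<dots> = (\<Prod>n<N. ennreal (exp ((b n)\<^sup>2 * (\<sigma> n)\<^sup>2 / 2)))"
  proof (intro prod.cong refl)
    fix n
    have "(\<integral>\<^sup>+\<omega>. ennreal (exp (b n * (X n \<omega> - \<mu> n))) \<partial>M) =
        (\<integral>\<^sup>+x. ennreal (exp (b n * (x - \<mu> n))) \<partial>distr M borel (X n))"
      by (subst nn_integral_distr) auto
    thus "(\<integral>\<^sup>+\<omega>. ennreal (exp (b n * (X n \<omega> - \<mu> n))) \<partial>M) = ennreal (exp ((b n)\<^sup>2 * (\<sigma> n)\<^sup>2 / 2))"
      by (simp add: distr_X nn_integral_exp_gaussian_law sigma_nonneg)
  qed
  finally show ?thesis
    by (simp add: prod_ennreal exp_sum sum_divide_distrib)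
qed

text \<open>An even power is dominated by the exponentials of the sum and of its negative, the
  latter being the same kind of sum with coefficients \<open>- b n\<close>. The bound depends on
  \<open>N\<close> only through the variance bound \<open>V\<close>.\<close>

lemma nn_integral_power_sum_le:
  assumes V: "(\<Sum>n<N. (b n)\<^sup>2 * (\<sigma> n)\<^sup>2) \<le> V"
  shows "(\<integral>\<^sup>+\<omega>. ennreal ((\<Sum>n<N. b n * (X n \<omega> - \<mu> n)) ^ (2 * k)) \<partial>M) \<le>
    ennreal (2 * fact (2 * k) * exp (V / 2))"
proof -
  let ?S = "\<lambda>b \<omega>. \<Sum>n<N. b n * (X n \<omega> - \<mu> n)"
  have neg: "?S (\<lambda>n. - b n) \<omega> = - ?S b \<omega>" for \<omega>
    by (simp add: sum_negf)
  have "(\<integral>\<^sup>+\<omega>. ennreal (?S b \<omega> ^ (2 * k)) \<partial>M) \<le>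
    (\<integral>\<^sup>+\<omega>. ennreal (fact (2 * k)) * (ennreal (exp (?S b \<omega>)) + ennreal (exp (?S (\<lambda>n. - b n) \<omega>))) \<partial>M)"
    using power_even_le_exp unfolding neg
    by (intro nn_integral_mono) (auto simp: ennreal_mult[symmetric] simp flip: ennreal_plus intro!: ennreal_leI)
  also have "\<dots> = ennreal (fact (2 * k)) * ((\<integral>\<^sup>+\<omega>. ennreal (exp (?S b \<omega>)) \<partial>M) +
      (\<integral>\<^sup>+\<omega>. ennreal (exp (?S (\<lambda>n. - b n) \<omega>)) \<partial>M))"
    by (subst nn_integral_cmult, measurable, subst nn_integral_add) measurable
  also have "\<dots> = ennreal (2 * fact (2 * k) * exp ((\<Sum>n<N. (b n)\<^sup>2 * (\<sigma> n)\<^sup>2) / 2))"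
    unfolding nn_integral_exp_sum by (simp add: ennreal_mult[symmetric] flip: ennreal_plus)
  also have "\<dots> \<le> ennreal (2 * fact (2 * k) * exp (V / 2))"
    using V by (intro ennreal_leI mult_left_mono) auto
  finally show ?thesis .
qed

text \<open>Real and imaginary parts are Gaussian sums whose variances are at most that of the
  moduli, so the real bound applies to each; hence the doubled constant 4.\<close>

lemma nn_integral_cmod_power_sum_le:
  fixes b :: "nat \<Rightarrow> complex"
  assumes V: "(\<Sum>n<N. (cmod (b n))\<^sup>2 * (\<sigma> n)\<^sup>2) \<le> V"
  shows "(\<integral>\<^sup>+\<omega>. ennreal (cmod (\<Sum>n<N. b n * complex_of_real (X n \<omega> - \<mu> n)) ^ (2 * k)) \<partial>M) \<le>
    ennreal (2 ^ k * (4 * fact (2 * k) * exp (V / 2)))"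
proof -
  let ?S = "\<lambda>b \<omega>. \<Sum>n<N. b n * (X n \<omega> - \<mu> n)"
  let ?R = "\<lambda>\<omega>. ?S (\<lambda>n. Re (b n)) \<omega>" and ?I = "\<lambda>\<omega>. ?S (\<lambda>n. Im (b n)) \<omega>"
  have "(\<integral>\<^sup>+\<omega>. ennreal (cmod (\<Sum>n<N. b n * complex_of_real (X n \<omega> - \<mu> n)) ^ (2 * k)) \<partial>M) \<le>
    (\<integral>\<^sup>+\<omega>. ennreal (2 ^ k) * (ennreal (?R \<omega> ^ (2 * k)) + ennreal (?I \<omega> ^ (2 * k))) \<partial>M)"
  proof (intro nn_integral_mono)
    fix \<omega>
    have "ennreal (cmod (\<Sum>n<N. b n * complex_of_real (X n \<omega> - \<mu> n)) ^ (2 * k)) \<le>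
       ennreal (2 ^ k * (?R \<omega> ^ (2 * k) + ?I \<omega> ^ (2 * k)))"
      using cmod_power_even_le[of "\<Sum>n<N. b n * complex_of_real (X n \<omega> - \<mu> n)" k]
      by (intro ennreal_leI) (simp del: of_real_diff)
    thus "ennreal (cmod (\<Sum>n<N. b n * complex_of_real (X n \<omega> - \<mu> n)) ^ (2 * k)) \<le>
       ennreal (2 ^ k) * (ennreal (?R \<omega> ^ (2 * k)) + ennreal (?I \<omega> ^ (2 * k)))"
      by (simp add: ennreal_mult ennreal_plus)
  qed
  also have "\<dots> = ennreal (2 ^ k) * ((\<integral>\<^sup>+\<omega>. ennreal (?R \<omega> ^ (2 * k)) \<partial>M) +
      (\<integral>\<^sup>+\<omega>. ennreal (?I \<omega> ^ (2 * k)) \<partial>M))"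
    by (subst nn_integral_cmult, measurable, subst nn_integral_add) measurable
  also have "\<dots> \<le> ennreal (2 ^ k) * (ennreal (2 * fact (2 * k) * exp (V / 2)) +
      ennreal (2 * fact (2 * k) * exp (V / 2)))"
  proof (intro mult_left_mono add_mono nn_integral_power_sum_le)
    have "(\<Sum>n<N. (Re (b n))\<^sup>2 * (\<sigma> n)\<^sup>2) \<le> (\<Sum>n<N. (cmod (b n))\<^sup>2 * (\<sigma> n)\<^sup>2)"
      by (intro sum_mono mult_right_mono) (auto simp: cmod_power2)
    thus "(\<Sum>n<N. (Re (b n))\<^sup>2 * (\<sigma> n)\<^sup>2) \<le> V" using V by simp
    have "(\<Sum>n<N. (Im (b n))\<^sup>2 * (\<sigma> n)\<^sup>2) \<le> (\<Sum>n<N. (cmod (b n))\<^sup>2 * (\<sigma> n)\<^sup>2)"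
      by (intro sum_mono mult_right_mono) (auto simp: cmod_power2)
    thus "(\<Sum>n<N. (Im (b n))\<^sup>2 * (\<sigma> n)\<^sup>2) \<le> V" using V by simp
  qed auto
  also have "\<dots> = ennreal (2 ^ k * (4 * fact (2 * k) * exp (V / 2)))"
    by (simp add: ennreal_mult[symmetric] flip: ennreal_plus)
  finally show ?thesis .
qed

text \<open>The expected sum of the squared moduli is finite, so the random coefficients are almost
  surely square-summable.\<close>

lemma AE_centered_conv_radius:
  assumes a: "a \<in> H2_coeffs" and S: "\<And>n. \<sigma> n \<le> S"
  shows "AE \<omega> in M. 1 \<le> conv_radius (\<lambda>n. a n * complex_of_real (X n \<omega> - \<mu> n))"
proof -
  let ?f = "\<lambda>n \<omega>. (cmod (a n * complex_of_real (X n \<omega> - \<mu> n)))\<^sup>2"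
  define K where "K = 4 * exp (S\<^sup>2 / 2)"
  have K: "(\<integral>\<^sup>+\<omega>. ennreal ((X n \<omega> - \<mu> n)\<^sup>2) \<partial>M) \<le> ennreal K" for n
  proof -
    \<comment> \<open>Coefficients concentrated at \<open>n\<close> isolate one variable; the power
      bound with exponent 2 then gives \<open>2 * fact 2 = 4\<close> in \<open>K\<close>.\<close>
    have "(\<Sum>m<Suc n. (if m = n then 1 else 0)\<^sup>2 * (\<sigma> m)\<^sup>2) \<le> S\<^sup>2"
      using S[of n] sigma_nonneg[of n] by (simp add: power_mono)
    from nn_integral_power_sum_le[OF this, of 1]
    show ?thesis by (simp add: K_def if_distrib[of "\<lambda>x. x * _"] cong: if_cong)
  qed
  have "(\<integral>\<^sup>+\<omega>. (\<Sum>n. ennreal (?f n \<omega>)) \<partial>M) = (\<Sum>n. \<integral>\<^sup>+\<omega>. ennreal (?f n \<omega>) \<partial>M)"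
    by (intro nn_integral_suminf) measurable
  also have "\<dots> \<le> (\<Sum>n. ennreal (K * (cmod (a n))\<^sup>2))"
  proof (intro suminf_le)
    fix n
    have "(\<integral>\<^sup>+\<omega>. ennreal (?f n \<omega>) \<partial>M) =
        ennreal ((cmod (a n))\<^sup>2) * (\<integral>\<^sup>+\<omega>. ennreal ((X n \<omega> - \<mu> n)\<^sup>2) \<partial>M)"
      by (subst nn_integral_cmult[symmetric], measurable)
         (simp add: norm_mult power_mult_distrib ennreal_mult del: of_real_diff)
    also have "\<dots> \<le> ennreal ((cmod (a n))\<^sup>2) * ennreal K"
      by (intro mult_left_mono K) auto
    finally show "(\<integral>\<^sup>+\<omega>. ennreal (?f n \<omega>) \<partial>M) \<le> ennreal (K * (cmod (a n))\<^sup>2)"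
      by (simp add: K_def ennreal_mult[symmetric] mult.commute)
  qed auto
  also have "\<dots> = ennreal (\<Sum>n. K * (cmod (a n))\<^sup>2)"
    using a by (intro suminf_ennreal2) (auto simp: H2_coeffs_def K_def)
  finally have "(\<integral>\<^sup>+\<omega>. (\<Sum>n. ennreal (?f n \<omega>)) \<partial>M) \<noteq> \<infinity>"
    by (auto simp: top_unique)
  hence "AE \<omega> in M. (\<Sum>n. ennreal (?f n \<omega>)) \<noteq> \<infinity>"
    by (intro nn_integral_PInf_AE) measurable
  thus ?thesis
  proof eventually_elim
    case (elim \<omega>)
    hence "summable (\<lambda>n. ?f n \<omega>)" by (intro summable_suminf_not_top) auto
    thus ?case by (intro conv_radius_H2) (simp add: H2_coeffs_def)
  qed
qed

lemma AE_centered_in_hardy: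
  assumes a: "a \<in> H2_coeffs" and S: "\<And>n. \<sigma> n \<le> S" and p: "0 < p"
  shows "AE \<omega> in M. hardy_size p (\<lambda>n. a n * complex_of_real (X n \<omega> - \<mu> n)) < \<infinity>"
proof -
  \<comment> \<open>This yields both \<open>0 < k\<close> and \<open>p \<le> 2 * k\<close>, as
    needed for the even-exponent bound and for the return to \<open>p\<close>.\<close>
  obtain k :: nat where k: "max 1 p \<le> real k" using real_arch_simple by blast
  let ?F = "\<lambda>N \<omega> t. cmod (\<Sum>n<N. a n * complex_of_real (X n \<omega> - \<mu> n) * cis t ^ n) ^ (2 * k)"
  let ?I = "\<lambda>N \<omega>. \<integral>\<^sup>+t\<in>{0..2*pi}. ennreal (?F N \<omega> t) \<partial>lborel"
  define V where "V = (\<Sum>n. (cmod (a n))\<^sup>2 * S\<^sup>2)"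
  define D where "D = 2 ^ k * (4 * fact (2 * k) * exp (V / 2))"
  have D0: "0 \<le> D" by (simp add: D_def)
  have sq: "(\<sigma> n)\<^sup>2 \<le> S\<^sup>2" for n
    using S[of n] sigma_nonneg[of n] by (intro power_mono)
  have [measurable]: "cis \<in> borel_measurable borel"
    by (intro borel_measurable_continuous_onI) (auto intro!: continuous_intros)
  have [measurable]: "(\<lambda>(\<omega>, t). ?F N \<omega> t) \<in> borel_measurable (M \<Otimes>\<^sub>M lborel)" for N
    by measurable
  interpret P: pair_sigma_finite M "lborel :: real measure" ..
  have I_le: "(\<integral>\<^sup>+\<omega>. ?I N \<omega> \<partial>M) \<le> ennreal (D * (2 * pi))" for N
  proof -
    \<comment> \<open>After the interchange a point of the circle is fixed first. The partial sum
      there has coefficients of modulus \<open>cmod (a n)\<close>, so \<open>V\<close> bounds the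
      variances uniformly in \<open>t\<close> and \<open>N\<close>.\<close>
    have "(\<integral>\<^sup>+\<omega>. ?I N \<omega> \<partial>M) = (\<integral>\<^sup>+t. \<integral>\<^sup>+\<omega>. ennreal (?F N \<omega> t) * indicator {0..2*pi} t \<partial>M \<partial>lborel)"
      by (rule P.Fubini'[symmetric]) measurable
    also have "\<dots> \<le> (\<integral>\<^sup>+t\<in>{0..2*pi}. ennreal D \<partial>lborel)"
    proof (intro nn_integral_mono)
      fix t
      have "(\<integral>\<^sup>+\<omega>. ennreal (?F N \<omega> t) \<partial>M) \<le> ennreal D"
      proof -
        have "(\<Sum>n<N. (cmod (a n * cis t ^ n))\<^sup>2 * (\<sigma> n)\<^sup>2) \<le> (\<Sum>n<N. (cmod (a n))\<^sup>2 * S\<^sup>2)"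
          by (intro sum_mono) (simp add: norm_mult norm_power mult_left_mono sq)
        also have "\<dots> \<le> V"
          unfolding V_def using a by (intro sum_le_suminf summable_mult2) (auto simp: H2_coeffs_def)
        finally have "(\<Sum>n<N. (cmod (a n * cis t ^ n))\<^sup>2 * (\<sigma> n)\<^sup>2) \<le> V" .
        from nn_integral_cmod_power_sum_le[OF this, of k] show ?thesis
          by (simp add: D_def mult_ac)
      qed
      thus "(\<integral>\<^sup>+\<omega>. ennreal (?F N \<omega> t) * indicator {0..2*pi} t \<partial>M) \<le> ennreal D * indicator {0..2*pi} t"
        by (auto simp: indicator_def)
    qed
    also have "\<dots> = ennreal (D * (2 * pi))"
      by (simp add: nn_integral_cmult_indicator ennreal_mult' D0)
    finally show ?thesis .
  qed
  have [measurable]: "?I N \<in> borel_measurable M" for N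
    by measurable
  \<comment> \<open>Fatou's lemma over \<open>M\<close> makes the liminf of the circle integrals
    almost surely finite, which is what \<open>hardy_size_even_le_liminf\<close> asks for; no
    convergence on the unit circle is claimed.\<close>
  have "(\<integral>\<^sup>+\<omega>. liminf (\<lambda>N. ?I N \<omega>) \<partial>M) \<le> liminf (\<lambda>N. \<integral>\<^sup>+\<omega>. ?I N \<omega> \<partial>M)"
    by (intro nn_integral_liminf) measurable
  also have "\<dots> \<le> liminf (\<lambda>N::nat. ennreal (D * (2 * pi)))"
    by (intro Liminf_mono always_eventually allI I_le)
  also have "\<dots> = ennreal (D * (2 * pi))" by (simp add: Liminf_const)
  finally have "(\<integral>\<^sup>+\<omega>. liminf (\<lambda>N. ?I N \<omega>) \<partial>M) \<noteq> \<infinity>"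
    by (auto simp: top_unique)
  hence "AE \<omega> in M. liminf (\<lambda>N. ?I N \<omega>) \<noteq> \<infinity>"
    by (intro nn_integral_PInf_AE) measurable
  with AE_centered_conv_radius[OF a S] show ?thesis
  proof eventually_elim
    case (elim \<omega>)
    have "hardy_size (real (2 * k)) (\<lambda>n. a n * complex_of_real (X n \<omega> - \<mu> n)) \<le> liminf (\<lambda>N. ?I N \<omega>)"
      using k by (intro hardy_size_even_le_liminf elim) auto
    also have "\<dots> < \<infinity>" using elim by (simp add: less_top)
    finally show ?case
      by (rule hardy_size_mono_exponent[rotated 2]) (use k p in auto)
  qed
qed

text \<open>Centring splits each coefficient into a random part, controlled by the bounded
  deviations, and a deterministic part, controlled by the multiplier property.\<close>

lemma L_property_if_bounded_multiplier:
  assumes p: "0 < p" and bdd: "bounded (range \<sigma>)"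
    and mult: "H2_multiplier p (\<lambda>n. complex_of_real (\<mu> n))"
  shows "L_property M p (\<lambda>n \<omega>. complex_of_real (X n \<omega>))"
  unfolding L_property_iff[OF p]
proof
  fix a assume a: "a \<in> H2_coeffs"
  obtain S where S: "\<And>n. \<sigma> n \<le> S"
    using bdd unfolding bounded_iff by (auto dest: order.trans[OF abs_ge_self])
  have mu: "hardy_size p (\<lambda>n. a n * complex_of_real (\<mu> n)) < \<infinity>"
    using mult a by (simp add: H2_multiplier_def series_in_hardy_iff[OF p])
  show "AE \<omega> in M. size_of p a (\<lambda>n. X n \<omega>) < \<infinity>"
    using AE_centered_in_hardy[OF a S p]
  proof eventually_elim
    case (elim \<omega>)
    have "size_of p a (\<lambda>n. X n \<omega>) = hardy_size p
        (\<lambda>n. a n * complex_of_real (X n \<omega> - \<mu> n) + a n * complex_of_real (\<mu> n))"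
      unfolding size_of_def by (simp add: algebra_simps)
    also have "\<dots> \<le> ennreal (2 powr p) * (hardy_size p (\<lambda>n. a n * complex_of_real (X n \<omega> - \<mu> n)) +
        hardy_size p (\<lambda>n. a n * complex_of_real (\<mu> n)))"
      by (rule hardy_size_add_le[OF p])
    also have "\<dots> < \<infinity>" using elim mu by (simp add: ennreal_mult_less_top)
    finally show ?case .
  qed
qed

end

theorem proposition5:
  fixes M :: "'a measure" and X :: "nat \<Rightarrow> 'a \<Rightarrow> real"
    and \<mu> \<sigma> :: "nat \<Rightarrow> real" and p :: real
  assumes "prob_space M"
    and "prob_space.indep_vars M (\<lambda>_. borel) X UNIV"
    and "\<And>n. gaussian_rv M (X n)"
    and "\<And>n. prob_space.expectation M (X n) = \<mu> n"
    and "\<And>n. prob_space.variance M (X n) = (\<sigma> n)\<^sup>2"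
    and "\<And>n. \<sigma> n \<ge> 0"
    and "0 < p"
  shows "L_property M p (\<lambda>n \<omega>. complex_of_real (X n \<omega>)) \<longleftrightarrow>
           bounded (range \<sigma>) \<and> H2_multiplier p (\<lambda>n. complex_of_real (\<mu> n))"
proof -
  interpret prob_space M by fact
  interpret gaussian_sequence M X \<mu> \<sigma>
    by unfold_locales (use assms distr_eq_gaussian_law in auto)
  show ?thesis
    using mean_multiplier_if_L_property bounded_sigma_if_L_property
      L_property_if_bounded_multiplier \<open>0 < p\<close> by blast
qed

end
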